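(* Let $n\geq 2$ and $1\leq s\leq n-1$. For $\alpha\in\mathbb{Z}^n$, let $\beta=(\beta_1,\dots,\beta_n)\in\mathbb{Z}^n$ be the multi-index with $\beta_j=\alpha_j+1$ for each $j$. Then, on the model domain $\Omega_{n,s}$: (1) For every $\alpha\in\mathbb{Z}^n$, $\|e_\alpha\|^2_{\Omega_{n,s}}<\infty$ if and only if $$\beta_j>0\quad\text{and}\quad\beta_j+\beta_\ell>0\qquad\text{for all } 1\leq j\leq s \text{ and } s+1\leq\ell\leq n.$$ (2) There are homogeneous polynomials $R_{n,s},S_{n,s}$ in $n$ variables with integer coefficients (depending only on $n$ and $s$) such that for every $\alpha\in\mathbb{Z}^n$ with $\|e_\alpha\|^2_{\Omega_{n,s}}<\infty$, $$\|e_\alpha\|^2_{\Omega_{n,s}}=\pi^n\cdot\frac{R_{n,s}(\beta)}{S_{n,s}(\beta)},$$ where $$S_{n,s}(\beta)=\prod_{j=1}^s\beta_j\prod_{\substack{1\leq j\leq s\\ s+1\leq\ell\leq n}}(\beta_j+\beta_\ell),$$ and $R_{n,s}$ is a homogeneous polynomial of total degree $(n-s)(s-1)$ such that $R_{n,s}$ and $S_{n,s}$ have no common factors. Furthermore, $R_{n,1}=1$.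
   Context: $\mathbb{D}^n=\{z\in\mathbb{C}^n \mid |z_j|<1 \text{ for } 1\leq j\leq n\}$ is the unit polydisc, and for $n\geq 2$, $1\leq s\leq n-1$, the model elementary domain of signature $s$ is $$\Omega_{n,s}=\{z\in\mathbb{D}^n \mid |z_1\cdots z_s|<|z_{s+1}z_{s+2}\cdots z_n|\}.$$ For $\alpha\in\mathbb{Z}^n$, $e_\alpha(z)=z^\alpha=z_1^{\alpha_1}\cdots z_n^{\alpha_n}$, and $\|e_\alpha\|^2_{\Omega_{n,s}}=\int_{\Omega_{n,s}}|e_\alpha(z)|^2\,dV(z)\in(0,\infty]$, where $dV$ is Lebesgue measure. *)

theory Defs
  imports "HOL-Analysis.Analysis" "HOL-Library.Poly_Mapping"
begin

text \<open>
  \<open>\<complex>\<^sup>n\<close> consists of the functions on \<open>{1..n}\<close>, extensional outside of it, and its Lebesgue measure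
  is the product of the planar Lebesgue measures. A multi-index is a function \<open>nat \<Rightarrow> int\<close>, of which
  only the values on \<open>{1..n}\<close> matter.
\<close>

definition lborel_Cn :: "nat \<Rightarrow> (nat \<Rightarrow> complex) measure" where
  "lborel_Cn n = Pi\<^sub>M {1..n} (\<lambda>_. lborel)"

definition polydisc :: "nat \<Rightarrow> (nat \<Rightarrow> complex) set" where
  "polydisc n = {z \<in> {1..n} \<rightarrow>\<^sub>E UNIV. \<forall>j\<in>{1..n}. cmod (z j) < 1}"

definition model_domain :: "nat \<Rightarrow> nat \<Rightarrow> (nat \<Rightarrow> complex) set" where
  "model_domain n s = {z \<in> polydisc n. cmod (\<Prod>j=1..s. z j) < cmod (\<Prod>l=s+1..n. z l)}"

text \<open>
  For a negative exponent the library sets \<open>0 powi k = 0\<close>; on the model domain this affects only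
  the null set on which one of the first \<open>s\<close> coordinates vanishes.
\<close>

definition monomial_fun :: "nat \<Rightarrow> (nat \<Rightarrow> int) \<Rightarrow> (nat \<Rightarrow> complex) \<Rightarrow> complex" where
  "monomial_fun n \<alpha> z = (\<Prod>j=1..n. z j powi \<alpha> j)"

definition norm_sq :: "nat \<Rightarrow> nat \<Rightarrow> (nat \<Rightarrow> int) \<Rightarrow> ennreal" where
  "norm_sq n s \<alpha> =
     (\<integral>\<^sup>+ z \<in> model_domain n s. ennreal ((cmod (monomial_fun n \<alpha> z))\<^sup>2) \<partial>lborel_Cn n)"

text \<open>
  Integer polynomials in the variables \<open>X\<^sub>0, X\<^sub>1, \<dots>\<close>: finitely supported maps from exponent vectors
  to coefficients, multiplied by convolution.
\<close>

type_synonym int_mpoly = "(nat \<Rightarrow>\<^sub>0 nat) \<Rightarrow>\<^sub>0 int"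

definition mvar :: "nat \<Rightarrow> int_mpoly" where
  "mvar i = Poly_Mapping.single (Poly_Mapping.single i 1) 1"

definition mvars :: "int_mpoly \<Rightarrow> nat set" where
  "mvars p = (\<Union>m\<in>Poly_Mapping.keys p. Poly_Mapping.keys m)"

definition meval :: "int_mpoly \<Rightarrow> (nat \<Rightarrow> int) \<Rightarrow> int" where
  "meval p x = (\<Sum>m\<in>Poly_Mapping.keys p. Poly_Mapping.lookup p m *
                 (\<Prod>i\<in>Poly_Mapping.keys m. x i ^ Poly_Mapping.lookup m i))"

text \<open>The zero polynomial is excluded, so that \<open>d\<close> is the total degree.\<close>

definition homogeneous_of_degree :: "nat \<Rightarrow> int_mpoly \<Rightarrow> bool" where
  "homogeneous_of_degree d p \<longleftrightarrow> p \<noteq> 0 \<and>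
     (\<forall>m\<in>Poly_Mapping.keys p. (\<Sum>i\<in>Poly_Mapping.keys m. Poly_Mapping.lookup m i) = d)"

text \<open>
  The class of the library's \<open>coprime\<close> is not instantiated for \<open>poly_mapping\<close>. Divisors of a nonzero
  polynomial in \<open>X\<^sub>1, \<dots>, X\<^sub>n\<close> involve no further variables, so \<open>d\<close> may range over the whole ring.
\<close>

definition no_common_factor :: "int_mpoly \<Rightarrow> int_mpoly \<Rightarrow> bool" where
  "no_common_factor p q \<longleftrightarrow> (\<forall>d. d dvd p \<longrightarrow> d dvd q \<longrightarrow> d dvd 1)"

end

theory Submission
  imports Defs
begin

text \<open>
  Put \<open>\<beta>\<^sub>j = \<alpha>\<^sub>j + 1\<close>, and let \<open>I(J, L)\<close> be the integral of the squared modulus of the monomial over the part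
  of the polydisc with coordinates \<open>J \<union> L\<close> where \<open>|\<Prod>\<^sub>J z\<^sub>j| < |\<Prod>\<^sub>L z\<^sub>l|\<close>. Pick \<open>j \<in> J\<close> and \<open>l \<in> L\<close> and split the domain
  according to which of \<open>|z\<^sub>j|\<close> and \<open>|z\<^sub>l|\<close> is smaller. Where \<open>|z\<^sub>j| < |z\<^sub>l|\<close>, the substitution
  \<open>z\<^sub>j = |z\<^sub>l| w\<close> cancels \<open>|z\<^sub>l|\<close> from the inequality, and the integral over \<open>z\<^sub>l\<close> splits off as the integral of
  \<open>|z|\<close> to the power \<open>2 (\<beta>\<^sub>j + \<beta>\<^sub>l - 1)\<close> over the disc. The other part is symmetric, so that
  \<open>I(J, L) = \<pi> / (\<beta>\<^sub>j + \<beta>\<^sub>l) \<cdot> (I(J, L - {l}) + I(J - {j}, L))\<close>, where the factor is infinite for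
  \<open>\<beta>\<^sub>j + \<beta>\<^sub>l \<le> 0\<close> (\<open>weighted_integral_insert_both\<close>). Moreover \<open>I(\<emptyset>, L) = 0\<close>, and \<open>I(J, \<emptyset>)\<close> is, for nonempty \<open>J\<close>,
  a product of integrals over the disc. All values lie in \<open>[0, \<infinity>]\<close>, so induction gives both the
  criterion for finiteness and the formula \<open>\<pi>\<^sup>n R / S\<close> (\<open>weighted_integral_eq\<close>), with \<open>R\<close> obtained from
  the same recursion after clearing denominators (\<open>numer\<close>). Degree and integrality of \<open>R\<close> are visible
  from this recursion.

  That \<open>R\<close> and \<open>S\<close> have no common factor follows because the factors \<open>X\<^sub>j\<close> and \<open>X\<^sub>j + X\<^sub>l\<close> of \<open>S\<close> are
  prime (\<open>prime_elem_mvar_plus\<close>), and each vanishes at a point where \<open>R\<close> is positive. The positivity is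
  again read off the recursion, all of whose terms are nonnegative where the factors of \<open>S\<close> are
  (\<open>numer_pos\<close>, \<open>numer_pos_wall\<close>).
\<close>

section \<open>Evaluation of integer polynomials\<close>

text \<open>
  The value of a monomial at a point of a commutative ring. The point may itself consist of
  polynomials, so that evaluation includes substitution.
\<close>
definition monom_eval :: "(nat \<Rightarrow> 'a::comm_ring_1) \<Rightarrow> (nat \<Rightarrow>\<^sub>0 nat) \<Rightarrow> 'a" where
  "monom_eval x m = (\<Prod>i\<in>Poly_Mapping.keys m. x i ^ Poly_Mapping.lookup m i)"

text \<open>
  The ring homomorphism from integer polynomials that sends the variable \<open>X\<^sub>i\<close> to \<open>x i\<close>.
\<close>
definition poly_eval :: "(nat \<Rightarrow> 'a::comm_ring_1) \<Rightarrow> int_mpoly \<Rightarrow> 'a" where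
  "poly_eval x p =
     (\<Sum>m\<in>Poly_Mapping.keys p. of_int (Poly_Mapping.lookup p m) * monom_eval x m)"

lemma meval_eq_poly_eval: "meval p x = poly_eval x p"
  by (simp add: meval_def poly_eval_def monom_eval_def)

lemma monom_eval_superset:
  assumes "finite K" "Poly_Mapping.keys m \<subseteq> K"
  shows "monom_eval x m = (\<Prod>i\<in>K. x i ^ Poly_Mapping.lookup m i)"
  unfolding monom_eval_def
  by (rule prod.mono_neutral_left) (use assms in \<open>auto simp: in_keys_iff\<close>)

lemma monom_eval_add: "monom_eval x (m + m') = monom_eval x m * monom_eval x m'"
proof -
  let ?K = "Poly_Mapping.keys m \<union> Poly_Mapping.keys m'"
  have "monom_eval x k = (\<Prod>i\<in>?K. x i ^ Poly_Mapping.lookup k i)" if "k \<in> {m, m', m + m'}" for k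
    by (rule monom_eval_superset) (use that Poly_Mapping.keys_add[of m m'] in auto)
  then show ?thesis
    by (simp add: lookup_add power_add prod.distrib)
qed

lemma poly_eval_superset:
  assumes "finite K" "Poly_Mapping.keys p \<subseteq> K"
  shows "poly_eval x p = (\<Sum>m\<in>K. of_int (Poly_Mapping.lookup p m) * monom_eval x m)"
  unfolding poly_eval_def
  by (rule sum.mono_neutral_left) (use assms in \<open>auto simp: in_keys_iff\<close>)

lemma poly_eval_zero [simp]: "poly_eval x 0 = 0"
  by (simp add: poly_eval_def)

lemma poly_eval_add: "poly_eval x (p + q) = poly_eval x p + poly_eval x q"
proof -
  let ?K = "Poly_Mapping.keys p \<union> Poly_Mapping.keys q"
  have "poly_eval x r = (\<Sum>m\<in>?K. of_int (Poly_Mapping.lookup r m) * monom_eval x m)"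
    if "r \<in> {p, q, p + q}" for r
    by (rule poly_eval_superset) (use that Poly_Mapping.keys_add[of p q] in auto)
  then show ?thesis
    by (simp add: lookup_add sum.distrib algebra_simps)
qed

lemma poly_eval_sum: "poly_eval x (sum f I) = (\<Sum>i\<in>I. poly_eval x (f i))"
  by (induction I rule: infinite_finite_induct) (auto simp: poly_eval_add)

lemma poly_eval_single: "poly_eval x (Poly_Mapping.single m c) = of_int c * monom_eval x m"
  by (simp add: poly_eval_def)

lemma poly_eval_mvar [simp]: "poly_eval x (mvar i) = x i"
  by (simp add: mvar_def poly_eval_single monom_eval_def)

lemma poly_eval_one [simp]: "poly_eval x 1 = 1"
  using poly_eval_single[of x 0 1] by (simp add: monom_eval_def)

lemma sum_of_monomials:
  fixes p :: "'a \<Rightarrow>\<^sub>0 'b::comm_monoid_add"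
  shows "p = (\<Sum>m\<in>Poly_Mapping.keys p. Poly_Mapping.single m (Poly_Mapping.lookup p m))"
  by (rule poly_mapping_eqI) (auto simp: lookup_sum lookup_single when_def in_keys_iff)

lemma poly_eval_mult: "poly_eval x (p * q) = poly_eval x p * poly_eval x q"
proof -
  have "p * q = (\<Sum>m\<in>Poly_Mapping.keys p. \<Sum>m'\<in>Poly_Mapping.keys q.
      Poly_Mapping.single (m + m') (Poly_Mapping.lookup p m * Poly_Mapping.lookup q m'))"
    by (subst (1) sum_of_monomials[of p], subst (1) sum_of_monomials[of q])
       (simp add: sum_product mult_single)
  then have "poly_eval x (p * q) = (\<Sum>m\<in>Poly_Mapping.keys p. \<Sum>m'\<in>Poly_Mapping.keys q.
      (of_int (Poly_Mapping.lookup p m) * monom_eval x m) *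
      (of_int (Poly_Mapping.lookup q m') * monom_eval x m'))"
    by (simp add: poly_eval_sum poly_eval_single monom_eval_add algebra_simps)
  also have "\<dots> = poly_eval x p * poly_eval x q"
    by (simp add: poly_eval_def sum_product)
  finally show ?thesis .
qed

lemma poly_eval_prod: "poly_eval x (prod f I) = (\<Prod>i\<in>I. poly_eval x (f i))"
  by (induction I rule: infinite_finite_induct) (auto simp: poly_eval_mult)

lemma mvar_power: "mvar i ^ k = Poly_Mapping.single (Poly_Mapping.single i k) 1"
  by (induction k) (auto simp: mvar_def mult_single simp flip: single_add)

lemma monom_eval_mvar: "monom_eval mvar m = Poly_Mapping.single m 1"
proof -
  have "(\<Prod>i\<in>I. mvar i ^ f i) = Poly_Mapping.single (\<Sum>i\<in>I. Poly_Mapping.single i (f i)) 1"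
    if "finite I" for I and f :: "nat \<Rightarrow> nat"
    using that by (induction I) (auto simp: mvar_power mult_single)
  then show ?thesis
    by (simp add: monom_eval_def flip: sum_of_monomials)
qed

lemma poly_eval_at_mvar: "poly_eval mvar p = p"
proof -
  have "of_int c * Poly_Mapping.single m 1 = Poly_Mapping.single m c" for c and m :: "nat \<Rightarrow>\<^sub>0 nat"
    by (simp add: mult_single flip: single_of_int)
  then show ?thesis
    by (simp add: poly_eval_def monom_eval_mvar flip: sum_of_monomials)
qed

section \<open>Prime linear forms\<close>

lemma dvd_diff_mult:
  fixes d :: "'a::comm_ring_1"
  assumes "d dvd a - b" "d dvd a' - b'"
  shows "d dvd a * a' - b * b'"
proof -
  have "a * a' - b * b' = (a - b) * a' + b * (a' - b')" by (simp add: algebra_simps)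
  then show ?thesis using assms by simp
qed

text \<open>
  Points that agree modulo \<open>d\<close> give values that agree modulo \<open>d\<close>.
\<close>
lemma poly_eval_cong_mod:
  fixes x y :: "nat \<Rightarrow> 'a::comm_ring_1"
  assumes "\<And>i. d dvd x i - y i"
  shows "d dvd poly_eval x p - poly_eval y p"
proof -
  have pow: "d dvd x i ^ k - y i ^ k" for i k
    by (induction k) (auto intro: dvd_diff_mult assms)
  have "d dvd (\<Prod>i\<in>I. x i ^ f i) - (\<Prod>i\<in>I. y i ^ f i)" if "finite I" for I f
    using that by induction (auto intro: dvd_diff_mult pow)
  then have "d dvd monom_eval x m - monom_eval y m" for m
    by (simp add: monom_eval_def)
  then show ?thesis
    by (auto simp: poly_eval_def simp flip: sum_subtractf right_diff_distrib intro!: dvd_sum)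
qed

text \<open>
  If \<open>L\<close> does not involve \<open>X\<^sub>j\<close>, the substitution \<open>X\<^sub>j := -L\<close> is an endomorphism of the polynomial
  ring, an integral domain, and its kernel is the ideal generated by \<open>X\<^sub>j + L\<close>: each variable
  changes by a multiple of \<open>X\<^sub>j + L\<close>. Hence that ideal is prime.
\<close>
lemma prime_elem_mvar_plus:
  assumes L: "poly_eval (mvar(j := - L)) L = L" and nz: "mvar j + L \<noteq> 0"
  shows "prime_elem (mvar j + L)"
proof -
  let ?\<sigma> = "mvar(j := - L)"
  have dvd_iff: "mvar j + L dvd f \<longleftrightarrow> poly_eval ?\<sigma> f = 0" for f
  proof
    assume "mvar j + L dvd f"
    then show "poly_eval ?\<sigma> f = 0"
      using L by (auto simp: poly_eval_mult poly_eval_add elim!: dvdE)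
  next
    assume "poly_eval ?\<sigma> f = 0"
    moreover have "mvar j + L dvd poly_eval mvar f - poly_eval ?\<sigma> f"
      by (rule poly_eval_cong_mod) auto
    ultimately show "mvar j + L dvd f"
      by (simp add: poly_eval_at_mvar)
  qed
  show ?thesis
    by (rule prime_elemI) (use nz in \<open>auto simp: dvd_iff poly_eval_mult\<close>)
qed

lemma prime_elem_mvar: "prime_elem (mvar j)"
proof -
  have "mvar j \<noteq> 0" using poly_eval_mvar[of "\<lambda>_. 1::int" j] by force
  then show ?thesis using prime_elem_mvar_plus[of j 0] by simp
qed

lemma prime_elem_mvar_plus_mvar:
  assumes "j \<noteq> l"
  shows "prime_elem (mvar j + mvar l)"
proof (rule prime_elem_mvar_plus)
  have "poly_eval (\<lambda>_. 1::int) (mvar j + mvar l) = 2" by (simp add: poly_eval_add)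
  then show "mvar j + mvar l \<noteq> 0" by force
qed (use assms in simp)

text \<open>
  A divisor of a product of primes that is divisible by none of them is a unit; unique factorization
  in the ambient ring is not needed.
\<close>
lemma coprime_prod_primes:
  fixes d :: "'a::idom"
  assumes "finite I" "\<And>i. i \<in> I \<Longrightarrow> prime_elem (p i)" "\<And>i. i \<in> I \<Longrightarrow> \<not> p i dvd d"
    and "d dvd (\<Prod>i\<in>I. p i)"
  shows "d dvd 1"
  using assms
proof (induction I)
  case (insert i I)
  then obtain e where e: "(\<Prod>i\<in>I. p i) * p i = d * e" by (auto simp: dvd_def mult.commute)
  then have "p i dvd d * e" by (metis dvd_triv_right)
  then obtain e' where "e = p i * e'"
    using insert.prems by (auto simp: prime_elem_dvd_mult_iff elim: dvdE)
  with e have "(\<Prod>i\<in>I. p i) * p i = (d * e') * p i" by (simp add: algebra_simps)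
  moreover have "p i \<noteq> 0" using insert.prems(1)[of i] by auto
  ultimately have "d dvd (\<Prod>i\<in>I. p i)" by simp
  then show ?case using insert by auto
qed simp

section \<open>Homogeneous polynomials in given variables\<close>

text \<open>
  The total degree of a monomial.
\<close>
definition mono_deg :: "(nat \<Rightarrow>\<^sub>0 nat) \<Rightarrow> nat" where
  "mono_deg m = (\<Sum>i\<in>Poly_Mapping.keys m. Poly_Mapping.lookup m i)"

lemma mono_deg_add: "mono_deg (m + m') = mono_deg m + mono_deg m'"
  unfolding mono_deg_def
  by (rule setsum_keys_plus_distrib) auto

text \<open>
  \<open>p\<close> is zero or homogeneous of degree \<open>d\<close>, and involves only variables with index in \<open>V\<close>. Admitting
  zero makes the notion closed under sums.
\<close>
definition form_in :: "nat set \<Rightarrow> nat \<Rightarrow> int_mpoly \<Rightarrow> bool" where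
  "form_in V d p \<longleftrightarrow> (\<forall>m\<in>Poly_Mapping.keys p. Poly_Mapping.keys m \<subseteq> V \<and> mono_deg m = d)"

lemma form_in_zero [simp]: "form_in V d 0" by (simp add: form_in_def)
lemma form_in_one: "form_in V 0 1" by (simp add: form_in_def mono_deg_def)
lemma form_in_mvar: "i \<in> V \<Longrightarrow> form_in V 1 (mvar i)"
  by (simp add: form_in_def mono_deg_def mvar_def)

lemma form_in_add: "form_in V d p \<Longrightarrow> form_in V d q \<Longrightarrow> form_in V d (p + q)"
  using Poly_Mapping.keys_add[of p q] by (auto simp: form_in_def)

lemma form_in_mult:
  assumes "form_in V d p" "form_in V e q"
  shows "form_in V (d + e) (p * q)"
  unfolding form_in_def
proof
  fix m assume "m \<in> Poly_Mapping.keys (p * q)"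
  then obtain a b where "m = a + b" "a \<in> Poly_Mapping.keys p" "b \<in> Poly_Mapping.keys q"
    using keys_mult[of p q] by auto
  then show "Poly_Mapping.keys m \<subseteq> V \<and> mono_deg m = d + e"
    using assms Poly_Mapping.keys_add[of a b] by (force simp: form_in_def mono_deg_add)
qed

lemma form_in_prod:
  assumes "finite I" "\<And>i. i \<in> I \<Longrightarrow> form_in V d (f i)"
  shows "form_in V (card I * d) (prod f I)"
  using assms
  by (induction I) (auto simp: form_in_one intro: form_in_mult)

lemma form_in_imp:
  assumes "form_in V d p" "p \<noteq> 0"
  shows "mvars p \<subseteq> V" "homogeneous_of_degree d p"
  using assms by (auto simp: form_in_def mvars_def homogeneous_of_degree_def mono_deg_def)

section \<open>The numerator and the denominator\<close>

text \<open>
  The numerator \<open>R\<close>, in an arbitrary commutative ring so that it is a polynomial for \<open>x = mvar\<close> and a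
  number for numerical \<open>x\<close>. The list \<open>js\<close> holds the indices on the smaller side of the inequality that
  defines the domain and \<open>ls\<close> those on the larger side. The equations are what remains of the
  recursion for the integrals once the denominators \<open>denom\<close> are cleared; an empty \<open>js\<close> corresponds to
  an empty domain.
\<close>
fun numer :: "(nat \<Rightarrow> 'a::comm_ring_1) \<Rightarrow> nat list \<Rightarrow> nat list \<Rightarrow> 'a" where
  "numer x [] ls = 0"
| "numer x (j # js) [] = 1"
| "numer x (j # js) (l # ls) =
     numer x (j # js) ls * (\<Prod>i\<in>set js. x i + x l) +
     numer x js (l # ls) * (x j * (\<Prod>k\<in>set ls. x j + x k))"

text \<open>
  The denominator \<open>S\<close>, likewise in an arbitrary commutative ring.
\<close>
definition denom :: "(nat \<Rightarrow> 'a::comm_ring_1) \<Rightarrow> nat set \<Rightarrow> nat set \<Rightarrow> 'a" where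
  "denom x J L = (\<Prod>j\<in>J. x j) * (\<Prod>j\<in>J. \<Prod>l\<in>L. x j + x l)"

lemma poly_eval_numer: "poly_eval x (numer mvar js ls) = numer x js ls"
  by (induction "mvar" js ls rule: numer.induct)
     (auto simp: poly_eval_add poly_eval_mult poly_eval_prod)

lemma of_int_numer: "of_int (numer x js ls) = numer (\<lambda>i. of_int (x i)) js ls"
  by (induction x js ls rule: numer.induct) auto

lemma poly_eval_denom: "poly_eval x (denom mvar J L) = denom x J L"
  by (auto simp: denom_def poly_eval_add poly_eval_mult poly_eval_prod)

lemma of_int_denom: "of_int (denom x J L) = denom (\<lambda>i. of_int (x i)) J L"
  by (auto simp: denom_def)

lemma numer_singleton: "numer x [j] ls = 1"
  by (induction ls) auto

lemma form_in_numer: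
  assumes "set js \<subseteq> V" "set ls \<subseteq> V" "distinct js" "distinct ls"
  shows "form_in V (length ls * (length js - 1)) (numer mvar js ls)"
  using assms
proof (induction "mvar" js ls rule: numer.induct)
  case (2 j js)
  then show ?case by (simp add: form_in_one)
next
  case (3 j js l ls)
  show ?case
  proof (cases "js = []")
    case True
    then show ?thesis by (simp only: numer_singleton) (simp add: form_in_one)
  next
    case False
    have "form_in V (length ls * length js + card (set js) * 1)
            (numer mvar (j # js) ls * (\<Prod>i\<in>set js. mvar i + mvar l))"
      using 3 by (intro form_in_mult form_in_prod form_in_add form_in_mvar) auto
    moreover have "form_in V (length (l # ls) * (length js - 1) + (1 + card (set ls) * 1))
            (numer mvar js (l # ls) * (mvar j * (\<Prod>k\<in>set ls. mvar j + mvar k)))"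
      using 3 by (intro form_in_mult form_in_prod form_in_add form_in_mvar) auto
    moreover obtain c where "length js = Suc c" using False by (cases js) auto
    ultimately show ?thesis
      unfolding numer.simps using 3
      by (intro form_in_add) (simp_all add: distinct_card algebra_simps)
  qed
qed simp

lemma numer_nonneg:
  fixes x :: "nat \<Rightarrow> 'a::linordered_idom"
  assumes "\<forall>j\<in>set js. x j \<ge> 0" "\<forall>j\<in>set js. \<forall>l\<in>set ls. x j + x l \<ge> 0"
  shows "numer x js ls \<ge> 0"
  using assms
proof (induction x js ls rule: numer.induct)
  case (3 x j js l ls)
  then have "(\<Prod>i\<in>set js. x i + x l) \<ge> 0" "(\<Prod>k\<in>set ls. x j + x k) \<ge> 0"
    by (auto intro!: prod_nonneg simp del: add_nonneg_nonneg)
  with 3 show ?case by auto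
qed auto

lemma numer_pos:
  fixes x :: "nat \<Rightarrow> 'a::linordered_idom"
  assumes "js \<noteq> []" "\<forall>j\<in>set js. x j \<ge> 0" "\<forall>j\<in>set js. \<forall>l\<in>set ls. x j + x l > 0"
  shows "numer x js ls > 0"
  using assms
proof (induction x js ls rule: numer.induct)
  case (3 x j js l ls)
  have "numer x js (l # ls) \<ge> 0"
    using 3 by (intro numer_nonneg) (auto intro: less_imp_le)
  moreover have "(\<Prod>i\<in>set js. x i + x l) > 0" "(\<Prod>k\<in>set ls. x j + x k) > 0"
    using 3 by (auto intro!: prod_pos)
  ultimately show ?case using 3
    by (auto intro!: add_pos_nonneg mult_nonneg_nonneg)
qed auto

text \<open>
  On the hyperplane \<open>x\<^sub>j\<^sub>0 + x\<^sub>l\<^sub>0 = 0\<close> the numerator remains positive as long as all the other linear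
  forms are positive; \<open>numer_pos\<close> already covers the hyperplanes \<open>x\<^sub>j = 0\<close>. These points show that no
  linear factor of the denominator divides the numerator.
\<close>
lemma numer_pos_wall:
  fixes x :: "nat \<Rightarrow> 'a::linordered_idom"
  assumes "distinct js" "distinct ls"
    and "\<forall>j\<in>set js. x j > 0"
    and "j0 \<in> set js" "l0 \<in> set ls" "x j0 + x l0 = 0"
    and "\<forall>j\<in>set js. \<forall>l\<in>set ls. (j, l) \<noteq> (j0, l0) \<longrightarrow> x j + x l > 0"
  shows "numer x js ls > 0"
  using assms
proof (induction x js ls rule: numer.induct)
  case (3 x j js l ls)
  have sums: "x i + x k \<ge> 0" if "i \<in> set (j # js)" "k \<in> set (l # ls)" for i k
    using 3(8,9) that by (cases "(i, k) = (j0, l0)") (auto intro: less_imp_le)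
  have nonneg: "numer x (j # js) ls \<ge> 0" "numer x js (l # ls) \<ge> 0"
    using 3(5) sums by (auto intro!: numer_nonneg intro: less_imp_le)
  \<comment> \<open>The first summand of the recursion vanishes exactly when the wall involves \<open>l\<close> but not \<open>j\<close>;
    the second one is then positive.\<close>
  show ?case
  proof (cases "l0 = l \<and> j0 \<noteq> j")
    case True
    then have "numer x js (l # ls) > 0" using 3 by auto
    moreover have "(\<Prod>k\<in>set ls. x j + x k) > 0"
      using 3 True by (intro prod_pos) auto
    moreover have "(\<Prod>i\<in>set js. x i + x l) \<ge> 0"
      using sums by (intro prod_nonneg) auto
    ultimately show ?thesis using nonneg 3(5)
      by (auto intro!: add_nonneg_pos)
  next
    case False
    have "numer x (j # js) ls > 0"
    proof (cases "l0 = l")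
      case True
      then show ?thesis using 3 by (intro numer_pos) (auto intro: less_imp_le)
    next
      case False
      then show ?thesis using 3 by auto
    qed
    moreover have "(\<Prod>i\<in>set js. x i + x l) > 0"
      using 3 False by (intro prod_pos) auto
    moreover have "(\<Prod>k\<in>set ls. x j + x k) \<ge> 0"
      using sums by (intro prod_nonneg) auto
    ultimately show ?thesis using nonneg 3(5)
      by (auto intro!: add_pos_nonneg mult_nonneg_nonneg intro: less_imp_le)
  qed
qed auto

lemma not_dvd_of_eval:
  fixes x :: "nat \<Rightarrow> int"
  assumes "poly_eval x p = 0" "poly_eval x q \<noteq> 0"
  shows "\<not> p dvd q"
  using assms by (auto simp: poly_eval_mult elim!: dvdE)

text \<open>
  The linear factors of the denominator are prime, and none of them divides the numerator, because
  each vanishes at some integer point where the numerator is positive.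
\<close>
lemma no_common_factor_numer_denom:
  assumes "distinct js" "distinct ls" "set js \<inter> set ls = {}" "js \<noteq> []"
  shows "no_common_factor (numer mvar js ls) (denom mvar (set js) (set ls))"
  unfolding no_common_factor_def
proof (intro allI impI)
  fix d :: int_mpoly
  assume dR: "d dvd numer mvar js ls" and dS: "d dvd denom mvar (set js) (set ls)"
  \<comment> \<open>\<open>Inl j\<close> indexes the factor \<open>X\<^sub>j\<close>, and \<open>Inr (j, l)\<close> the factor \<open>X\<^sub>j + X\<^sub>l\<close>.\<close>
  define I where "I = Inl ` set js \<union> Inr ` (set js \<times> set ls)"
  define p :: "nat + nat \<times> nat \<Rightarrow> int_mpoly"
    where "p = case_sum mvar (\<lambda>(j, l). mvar j + mvar l)"
  have "denom mvar (set js) (set ls) = (\<Prod>i\<in>I. p i)"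
    unfolding I_def denom_def
    by (subst prod.union_disjoint)
       (auto simp: p_def prod.reindex prod.cartesian_product inj_on_def)
  moreover have "prime_elem (p i)" if "i \<in> I" for i
    using that assms by (auto simp: I_def p_def intro!: prime_elem_mvar prime_elem_mvar_plus_mvar)
  moreover have "\<not> p i dvd d" if "i \<in> I" for i
  proof -
    have "\<exists>x. poly_eval x (p i) = (0::int) \<and> numer x js ls > 0"
      using \<open>i \<in> I\<close> unfolding I_def
    proof (elim UnE imageE; clarify)
      fix j assume "j \<in> set js"
      define x :: "nat \<Rightarrow> int" where "x = (\<lambda>_. 1)(j := 0)"
      have "numer x js ls > 0"
        using assms \<open>j \<in> set js\<close> by (intro numer_pos) (auto simp: x_def)
      then show "\<exists>x. poly_eval x (p (Inl j)) = (0::int) \<and> numer x js ls > 0"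
        by (intro exI[of _ x]) (simp add: p_def x_def)
    next
      fix j l assume jl: "j \<in> set js" "l \<in> set ls"
      define x :: "nat \<Rightarrow> int" where
        "x = (\<lambda>i. if i = l then - 1 else if i \<in> set js \<and> i \<noteq> j then 2 else 1)"
      have "x j + x l = 0" using jl assms(3) by (auto simp: x_def)
      moreover have "numer x js ls > 0"
        using assms jl by (intro numer_pos_wall[of js ls x j l]) (auto simp: x_def)
      ultimately show "\<exists>x. poly_eval x (p (Inr (j, l))) = (0::int) \<and> numer x js ls > 0"
        by (intro exI[of _ x]) (simp add: p_def poly_eval_add)
    qed
    then obtain x where "poly_eval x (p i) = (0::int)" "numer x js ls > 0" by blast
    then have "\<not> p i dvd numer mvar js ls"
      by (intro not_dvd_of_eval[of x]) (auto simp: poly_eval_numer)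
    then show ?thesis using dR dvd_trans by blast
  qed
  ultimately show "d dvd 1"
    using coprime_prod_primes[of I p d] dS by (auto simp: I_def)
qed

section \<open>Powers of the modulus on the disc\<close>

text \<open>
  The function \<open>|z|\<^sup>2\<^sup>k\<close> on the open unit disc, extended by zero. At the origin it is zero when \<open>k\<close> is
  negative, by the convention for \<open>powi\<close>.
\<close>
definition disc_power :: "int \<Rightarrow> complex \<Rightarrow> ennreal" where
  "disc_power k z = (if cmod z < 1 then ennreal ((cmod z powi k)\<^sup>2) else 0)"

text \<open>
  The integral of \<open>|z|\<^sup>2\<^sup>k\<close> over the disc.
\<close>
definition disc_integral :: "int \<Rightarrow> ennreal" where
  "disc_integral k = (\<integral>\<^sup>+z. disc_power k z \<partial>lborel)"

lemma measurable_disc_power [measurable]: "disc_power k \<in> borel_measurable borel"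
  unfolding disc_power_def power_int_def by measurable

lemma AE_norm_neq: "AE z in (lborel :: complex measure). cmod z \<noteq> r"
proof (rule AE_I')
  show "sphere 0 r \<in> null_sets (lborel :: complex measure)"
    using negligible_sphere[of "0::complex" r]
    by (simp add: negligible_iff_null_sets null_sets_completion_iff)
qed auto

lemma nn_integral_scale_complex:
  fixes f :: "complex \<Rightarrow> ennreal"
  assumes [measurable]: "f \<in> borel_measurable borel" and "r > 0"
  shows "(\<integral>\<^sup>+z. f z \<partial>lborel) = ennreal (r\<^sup>2) * (\<integral>\<^sup>+w. f (r *\<^sub>R w) \<partial>lborel)"
proof -
  have "(\<integral>\<^sup>+z. f z \<partial>lborel) =
      (\<integral>\<^sup>+z. f z \<partial>(density (distr lborel borel (\<lambda>w. 0 + r *\<^sub>R w)) (\<lambda>_. ennreal (\<bar>r\<bar> ^ DIM(complex)))))"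
    using lborel_affine[of r "0::complex"] assms(2) by simp
  also have "\<dots> = ennreal (r\<^sup>2) * (\<integral>\<^sup>+w. f (r *\<^sub>R w) \<partial>lborel)"
    by (simp add: nn_integral_density nn_integral_distr nn_integral_cmult)
  finally show ?thesis .
qed

text \<open>
  The substitution \<open>z = r w\<close> in an integral over the disc of radius \<open>r\<close>, for a kernel that is
  homogeneous of degree zero.
\<close>
lemma nn_integral_small_disc:
  fixes g :: "real \<Rightarrow> real \<Rightarrow> ennreal"
  assumes [measurable]: "case_prod g \<in> borel_measurable (borel \<Otimes>\<^sub>M borel)"
    and hom: "\<And>c r t. c > 0 \<Longrightarrow> g (c * r) (c * t) = g r t"
    and r: "0 < r" "r < 1"
  shows "(\<integral>\<^sup>+z. (if cmod z < r then disc_power a z * g (cmod z) r else 0) \<partial>lborel) =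
    ennreal ((r powi (a + 1))\<^sup>2) * (\<integral>\<^sup>+w. disc_power a w * g (cmod w) 1 \<partial>lborel)"
proof -
  have "(\<integral>\<^sup>+z. (if cmod z < r then disc_power a z * g (cmod z) r else 0) \<partial>lborel) =
    ennreal (r\<^sup>2) * (\<integral>\<^sup>+w. (if cmod (r *\<^sub>R w) < r
        then disc_power a (r *\<^sub>R w) * g (cmod (r *\<^sub>R w)) r else 0) \<partial>lborel)"
    by (rule nn_integral_scale_complex) (use r in measurable)
  also have "\<dots> = ennreal (r\<^sup>2) * (\<integral>\<^sup>+w. ennreal ((r powi a)\<^sup>2) * (disc_power a w * g (cmod w) 1) \<partial>lborel)"
  proof (intro arg_cong[where f = "(*) (ennreal (r\<^sup>2))"] nn_integral_cong)
    fix w :: complex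
    show "(if cmod (r *\<^sub>R w) < r then disc_power a (r *\<^sub>R w) * g (cmod (r *\<^sub>R w)) r else 0) =
      ennreal ((r powi a)\<^sup>2) * (disc_power a w * g (cmod w) 1)"
    proof (cases "cmod w < 1")
      case True
      then have "r * cmod w < r" using r by simp
      moreover from this have "r * cmod w < 1" using r by linarith
      ultimately show ?thesis using True r hom[of r "cmod w" 1]
        by (simp add: disc_power_def power_int_mult_distrib power_mult_distrib ennreal_mult mult.assoc)
    next
      case False
      then have "\<not> r * cmod w < r" using r by simp
      then show ?thesis using False r by (simp add: disc_power_def)
    qed
  qed
  also have "\<dots> = ennreal (r\<^sup>2) * (ennreal ((r powi a)\<^sup>2) * (\<integral>\<^sup>+w. disc_power a w * g (cmod w) 1 \<partial>lborel))"
    by (subst nn_integral_cmult) auto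
  also have "\<dots> = ennreal ((r powi (a + 1))\<^sup>2) * (\<integral>\<^sup>+w. disc_power a w * g (cmod w) 1 \<partial>lborel)"
    using r by (simp add: power_int_add power_mult_distrib ennreal_mult' ac_simps)
  finally show ?thesis .
qed

text \<open>
  The part \<open>|z| < |u|\<close> of an integral over the bidisc: putting \<open>z = |u| w\<close> separates the variables, and
  the Jacobian \<open>|u|\<^sup>2\<close> raises the exponent of \<open>|u|\<^sup>2\<close> to \<open>a + b + 1\<close>.
\<close>
lemma disc_pair_integral_less:
  fixes g :: "real \<Rightarrow> real \<Rightarrow> ennreal"
  assumes meas [measurable]: "case_prod g \<in> borel_measurable (borel \<Otimes>\<^sub>M borel)"
    and hom: "\<And>c r t. c > 0 \<Longrightarrow> g (c * r) (c * t) = g r t"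
  shows "(\<integral>\<^sup>+u. \<integral>\<^sup>+z. (if cmod z < cmod u
        then disc_power a z * disc_power b u * g (cmod z) (cmod u) else 0) \<partial>lborel \<partial>lborel) =
    disc_integral (a + b + 1) * (\<integral>\<^sup>+w. disc_power a w * g (cmod w) 1 \<partial>lborel)"
proof -
  let ?C = "\<integral>\<^sup>+w. disc_power a w * g (cmod w) 1 \<partial>lborel"
  have "(\<integral>\<^sup>+u. \<integral>\<^sup>+z. (if cmod z < cmod u
        then disc_power a z * disc_power b u * g (cmod z) (cmod u) else 0) \<partial>lborel \<partial>lborel) =
    (\<integral>\<^sup>+u. disc_power (a + b + 1) u * ?C \<partial>lborel)"
  proof (rule nn_integral_cong_AE, use AE_norm_neq[of 0] in eventually_elim)
    fix u :: complex assume u: "cmod u \<noteq> 0"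
    have "(\<integral>\<^sup>+z. (if cmod z < cmod u
        then disc_power a z * disc_power b u * g (cmod z) (cmod u) else 0) \<partial>lborel) =
      (\<integral>\<^sup>+z. disc_power b u * (if cmod z < cmod u then disc_power a z * g (cmod z) (cmod u) else 0) \<partial>lborel)"
      by (intro nn_integral_cong) (auto simp: ac_simps)
    also have "\<dots> = disc_power b u *
        (\<integral>\<^sup>+z. (if cmod z < cmod u then disc_power a z * g (cmod z) (cmod u) else 0) \<partial>lborel)"
      by (rule nn_integral_cmult) measurable
    also have "\<dots> = disc_power (a + b + 1) u * ?C"
    proof (cases "cmod u < 1")
      case True
      have "cmod u powi (a + b + 1) = cmod u powi b * cmod u powi (a + 1)"
        using u by (subst power_int_add [symmetric]) (auto simp: ac_simps)
      then show ?thesis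
        using True u nn_integral_small_disc[OF meas hom, of "cmod u" a]
        by (simp add: disc_power_def power_mult_distrib ennreal_mult mult.assoc)
    qed (simp add: disc_power_def)
    finally show "(\<integral>\<^sup>+z. (if cmod z < cmod u
        then disc_power a z * disc_power b u * g (cmod z) (cmod u) else 0) \<partial>lborel) =
      disc_power (a + b + 1) u * ?C" .
  qed
  also have "\<dots> = disc_integral (a + b + 1) * ?C"
    unfolding disc_integral_def by (rule nn_integral_multc) measurable
  finally show ?thesis .
qed

text \<open>
  The bidisc is the union of its parts \<open>|z| < |u|\<close> and \<open>|u| < |z|\<close>, up to a null set.
\<close>
lemma disc_pair_integral:
  fixes g :: "real \<Rightarrow> real \<Rightarrow> ennreal"
  assumes meas [measurable]: "case_prod g \<in> borel_measurable (borel \<Otimes>\<^sub>M borel)"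
    and hom: "\<And>c r t. c > 0 \<Longrightarrow> g (c * r) (c * t) = g r t"
  shows "(\<integral>\<^sup>+z. \<integral>\<^sup>+u. disc_power a z * disc_power b u * g (cmod z) (cmod u) \<partial>lborel \<partial>lborel) =
    disc_integral (a + b + 1) *
    ((\<integral>\<^sup>+w. disc_power a w * g (cmod w) 1 \<partial>lborel) + (\<integral>\<^sup>+w. disc_power b w * g 1 (cmod w) \<partial>lborel))"
proof -
  let ?G = "\<lambda>z u. disc_power a z * disc_power b u * g (cmod z) (cmod u)"
  have "(\<integral>\<^sup>+z. \<integral>\<^sup>+u. ?G z u \<partial>lborel \<partial>lborel) =
    (\<integral>\<^sup>+z. (\<integral>\<^sup>+u. (if cmod z < cmod u then ?G z u else 0) \<partial>lborel) +
          (\<integral>\<^sup>+u. (if cmod u < cmod z then ?G z u else 0) \<partial>lborel) \<partial>lborel)"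
  proof (rule nn_integral_cong)
    fix z :: complex
    have "(\<integral>\<^sup>+u. ?G z u \<partial>lborel) =
      (\<integral>\<^sup>+u. (if cmod z < cmod u then ?G z u else 0) + (if cmod u < cmod z then ?G z u else 0) \<partial>lborel)"
      by (rule nn_integral_cong_AE, use AE_norm_neq[of "cmod z"] in eventually_elim) auto
    then show "(\<integral>\<^sup>+u. ?G z u \<partial>lborel) =
      (\<integral>\<^sup>+u. (if cmod z < cmod u then ?G z u else 0) \<partial>lborel) +
      (\<integral>\<^sup>+u. (if cmod u < cmod z then ?G z u else 0) \<partial>lborel)"
      by (simp add: nn_integral_add)
  qed
  also have "\<dots> = (\<integral>\<^sup>+z. \<integral>\<^sup>+u. (if cmod z < cmod u then ?G z u else 0) \<partial>lborel \<partial>lborel) +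
          (\<integral>\<^sup>+z. \<integral>\<^sup>+u. (if cmod u < cmod z then ?G z u else 0) \<partial>lborel \<partial>lborel)"
    by (rule nn_integral_add) measurable
  also have "(\<integral>\<^sup>+z. \<integral>\<^sup>+u. (if cmod z < cmod u then ?G z u else 0) \<partial>lborel \<partial>lborel) =
    (\<integral>\<^sup>+u. \<integral>\<^sup>+z. (if cmod z < cmod u then ?G z u else 0) \<partial>lborel \<partial>lborel)"
    by (rule lborel_pair.Fubini') measurable
  also have "\<dots> = disc_integral (a + b + 1) * (\<integral>\<^sup>+w. disc_power a w * g (cmod w) 1 \<partial>lborel)"
    by (rule disc_pair_integral_less) (use hom in auto)
  also have "(\<integral>\<^sup>+z. \<integral>\<^sup>+u. (if cmod u < cmod z then ?G z u else 0) \<partial>lborel \<partial>lborel) =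
    disc_integral (a + b + 1) * (\<integral>\<^sup>+w. disc_power b w * g 1 (cmod w) \<partial>lborel)"
    using disc_pair_integral_less[of "\<lambda>r t. g t r" b a] hom
    by (simp add: ac_simps cong: if_cong)
  finally show ?thesis
    by (simp add: distrib_left)
qed

text \<open>
  The case of a constant kernel. With \<open>b = 0\<close> it determines all the integrals of \<open>|z|\<^sup>2\<^sup>k\<close> over the disc
  from its area, without polar coordinates.
\<close>
lemma disc_integral_mult:
  "disc_integral a * disc_integral b = disc_integral (a + b + 1) * (disc_integral a + disc_integral b)"
  using disc_pair_integral[of "\<lambda>_ _. 1" a b]
  by (simp add: disc_integral_def nn_integral_cmult nn_integral_multc)

lemma disc_integral_0: "disc_integral 0 = ennreal pi"
proof -
  have "disc_integral 0 = (\<integral>\<^sup>+z. indicator (ball 0 1) z \<partial>(lborel :: complex measure))"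
    unfolding disc_integral_def
    by (intro nn_integral_cong) (auto simp: disc_power_def indicator_def)
  also have "\<dots> = ennreal pi"
    by (simp add: emeasure_ball unit_ball_vol_2)
  finally show ?thesis .
qed

lemma ennreal_eq_divideI:
  assumes "x * ennreal c = ennreal d" "c > 0" "d \<ge> 0"
  shows "x = ennreal (d / c)"
proof (cases x)
  case (real r)
  then have "r * c = d" using assms by (simp add: ennreal_mult[symmetric])
  then have "r = d / c" using assms(2) by (auto simp: field_simps)
  then show ?thesis using real by simp
qed (use assms in \<open>simp add: ennreal_top_mult\<close>)

lemma disc_integral_nat: "disc_integral (int k) = ennreal (pi / (real k + 1))"
proof (induction k)
  case (Suc k)
  let ?c = "pi / (real k + 1)"
  have c: "?c > 0" by simp
  have sum: "ennreal ?c + ennreal pi = ennreal (?c + pi)"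
    using c by (subst ennreal_plus) auto
  have prod: "ennreal ?c * ennreal pi = ennreal (?c * pi)"
    by (subst ennreal_mult) auto
  have "int k + 0 + 1 = int (Suc k)" by simp
  then have "disc_integral (int (Suc k)) * ennreal (?c + pi) = ennreal (?c * pi)"
    using disc_integral_mult[of "int k" 0] by (simp only: Suc disc_integral_0 sum prod)
  then have "disc_integral (int (Suc k)) = ennreal (?c * pi / (?c + pi))"
    by (rule ennreal_eq_divideI) (use c in \<open>auto intro: add_pos_pos\<close>)
  also have "?c * pi / (?c + pi) = pi / (real (Suc k) + 1)"
  proof -
    have "?c + pi = pi * (real (Suc k) + 1) / (real k + 1)"
      by (simp add: field_simps)
    then show ?thesis by simp
  qed
  finally show ?case .
qed (simp add: disc_integral_0)

lemma disc_integral_neg: "disc_integral (- int k - 1) = \<infinity>"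
proof (induction k)
  case 0
  have "disc_integral (- 1) * ennreal pi = ennreal pi * (disc_integral (- 1) + ennreal pi)"
    using disc_integral_mult[of "- 1" 0] by (simp add: disc_integral_0)
  then show ?case
    by (cases "disc_integral (- 1)") (auto simp: algebra_simps simp flip: ennreal_mult ennreal_plus)
next
  case (Suc k)
  let ?x = "disc_integral (- int (Suc k) - 1)"
  have "- int (Suc k) - 1 + 0 + 1 = - int k - 1" by simp
  then have "?x * ennreal pi = \<infinity> * (?x + ennreal pi)"
    using disc_integral_mult[of "- int (Suc k) - 1" 0] by (simp only: Suc disc_integral_0)
  then show ?case
    by (cases ?x) (simp_all add: ennreal_top_mult flip: ennreal_mult)
qed

lemma disc_integral_eq:
  "disc_integral k = (if k + 1 > 0 then ennreal (pi / (real_of_int k + 1)) else \<infinity>)"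
proof (cases "k + 1 > 0")
  case True
  then show ?thesis using disc_integral_nat[of "nat k"] by simp
next
  case False
  then show ?thesis using disc_integral_neg[of "nat (- k - 1)"] by simp
qed

section \<open>Integrals over the polydisc\<close>

text \<open>
  The integral of the squared modulus of a monomial over the part of the polydisc, with coordinates
  indexed by \<open>J \<union> L\<close>, where \<open>r |\<Prod>\<^sub>J z\<^sub>j| < t |\<Prod>\<^sub>L z\<^sub>l|\<close>. The parameters \<open>r\<close> and \<open>t\<close> carry the
  moduli of coordinates that are integrated later.
\<close>
definition weighted_integral :: "(nat \<Rightarrow> int) \<Rightarrow> nat set \<Rightarrow> nat set \<Rightarrow> real \<Rightarrow> real \<Rightarrow> ennreal" where
  "weighted_integral \<alpha> J L r t =
     (\<integral>\<^sup>+z. (\<Prod>i\<in>J \<union> L. disc_power (\<alpha> i) (z i)) *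
        (if r * (\<Prod>j\<in>J. cmod (z j)) < t * (\<Prod>l\<in>L. cmod (z l)) then 1 else 0)
      \<partial>Pi\<^sub>M (J \<union> L) (\<lambda>_. lborel))"

interpretation lborel_product: product_sigma_finite "\<lambda>_::nat. lborel :: complex measure" ..

lemma prod_if_notin:
  "a \<notin> I \<Longrightarrow> (\<Prod>i\<in>I. g i (if i = a then w else z i)) = (\<Prod>i\<in>I. g i (z i))"
  by (rule prod.cong) auto

lemma weighted_integral_insert_left:
  assumes "finite J" "finite L" "a \<notin> J \<union> L"
  shows "weighted_integral \<alpha> (insert a J) L r t =
    (\<integral>\<^sup>+w. disc_power (\<alpha> a) w * weighted_integral \<alpha> J L (r * cmod w) t \<partial>lborel)"
proof -
  have "weighted_integral \<alpha> (insert a J) L r t =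
    (\<integral>\<^sup>+w. \<integral>\<^sup>+z. (\<Prod>i\<in>insert a (J \<union> L). disc_power (\<alpha> i) ((z(a := w)) i)) *
        (if r * (\<Prod>j\<in>insert a J. cmod ((z(a := w)) j)) < t * (\<Prod>l\<in>L. cmod ((z(a := w)) l)) then 1 else 0)
      \<partial>Pi\<^sub>M (J \<union> L) (\<lambda>_. lborel) \<partial>lborel)"
    unfolding weighted_integral_def Un_insert_left
    by (subst lborel_product.product_nn_integral_insert_rev) (use assms in auto)
  also have "\<dots> = (\<integral>\<^sup>+w. \<integral>\<^sup>+z. disc_power (\<alpha> a) w * ((\<Prod>i\<in>J \<union> L. disc_power (\<alpha> i) (z i)) *
        (if (r * cmod w) * (\<Prod>j\<in>J. cmod (z j)) < t * (\<Prod>l\<in>L. cmod (z l)) then 1 else 0))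
      \<partial>Pi\<^sub>M (J \<union> L) (\<lambda>_. lborel) \<partial>lborel)"
    using assms by (intro nn_integral_cong)
      (simp add: mult.assoc prod_if_notin[where g = "\<lambda>i. disc_power (\<alpha> i)"]
         prod_if_notin[where g = "\<lambda>_. cmod"])
  also have "\<dots> = (\<integral>\<^sup>+w. disc_power (\<alpha> a) w * weighted_integral \<alpha> J L (r * cmod w) t \<partial>lborel)"
    unfolding weighted_integral_def
    by (intro nn_integral_cong nn_integral_cmult) (use assms in measurable)
  finally show ?thesis .
qed

lemma weighted_integral_insert_right:
  assumes "finite J" "finite L" "b \<notin> J \<union> L"
  shows "weighted_integral \<alpha> J (insert b L) r t =
    (\<integral>\<^sup>+w. disc_power (\<alpha> b) w * weighted_integral \<alpha> J L r (t * cmod w) \<partial>lborel)"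
proof -
  have "weighted_integral \<alpha> J (insert b L) r t =
    (\<integral>\<^sup>+w. \<integral>\<^sup>+z. (\<Prod>i\<in>insert b (J \<union> L). disc_power (\<alpha> i) ((z(b := w)) i)) *
        (if r * (\<Prod>j\<in>J. cmod ((z(b := w)) j)) < t * (\<Prod>l\<in>insert b L. cmod ((z(b := w)) l)) then 1 else 0)
      \<partial>Pi\<^sub>M (J \<union> L) (\<lambda>_. lborel) \<partial>lborel)"
    unfolding weighted_integral_def Un_insert_right
    by (subst lborel_product.product_nn_integral_insert_rev) (use assms in auto)
  also have "\<dots> = (\<integral>\<^sup>+w. \<integral>\<^sup>+z. disc_power (\<alpha> b) w * ((\<Prod>i\<in>J \<union> L. disc_power (\<alpha> i) (z i)) *
        (if r * (\<Prod>j\<in>J. cmod (z j)) < (t * cmod w) * (\<Prod>l\<in>L. cmod (z l)) then 1 else 0))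
      \<partial>Pi\<^sub>M (J \<union> L) (\<lambda>_. lborel) \<partial>lborel)"
    using assms by (intro nn_integral_cong)
      (simp add: mult.assoc prod_if_notin[where g = "\<lambda>i. disc_power (\<alpha> i)"]
         prod_if_notin[where g = "\<lambda>_. cmod"])
  also have "\<dots> = (\<integral>\<^sup>+w. disc_power (\<alpha> b) w * weighted_integral \<alpha> J L r (t * cmod w) \<partial>lborel)"
    unfolding weighted_integral_def
    by (intro nn_integral_cong nn_integral_cmult) (use assms in measurable)
  finally show ?thesis .
qed

lemma measurable_weighted_integral:
  assumes "finite J" "finite L"
  shows "case_prod (weighted_integral \<alpha> J L) \<in> borel_measurable (borel \<Otimes>\<^sub>M borel)"
proof -
  interpret P: sigma_finite_measure "Pi\<^sub>M (J \<union> L) (\<lambda>_. lborel :: complex measure)"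
    by (rule lborel_product.sigma_finite) (use assms in auto)
  show ?thesis
    unfolding weighted_integral_def case_prod_beta'
    by measurable
qed

lemma weighted_integral_scale:
  assumes "c > 0"
  shows "weighted_integral \<alpha> J L (c * r) (c * t) = weighted_integral \<alpha> J L r t"
  using assms by (simp add: weighted_integral_def mult.assoc)

text \<open>
  The recursion on which everything rests. Integrating first over all coordinates but \<open>z\<^sub>a\<close> and \<open>z\<^sub>b\<close> leaves a
  kernel in \<open>|z\<^sub>a|\<close> and \<open>|z\<^sub>b|\<close> that is homogeneous of degree zero.
\<close>
lemma weighted_integral_insert_both:
  assumes "finite J" "finite L" "a \<notin> J \<union> L" "b \<notin> J \<union> L" "a \<noteq> b"
  shows "weighted_integral \<alpha> (insert a J) (insert b L) 1 1 =
    disc_integral (\<alpha> a + \<alpha> b + 1) *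
    (weighted_integral \<alpha> (insert a J) L 1 1 + weighted_integral \<alpha> J (insert b L) 1 1)"
proof -
  have [measurable]: "case_prod (weighted_integral \<alpha> J L) \<in> borel_measurable (borel \<Otimes>\<^sub>M borel)"
    using assms measurable_weighted_integral by auto
  have "weighted_integral \<alpha> (insert a J) (insert b L) 1 1 =
    (\<integral>\<^sup>+z. disc_power (\<alpha> a) z * (\<integral>\<^sup>+u. disc_power (\<alpha> b) u *
       weighted_integral \<alpha> J L (cmod z) (cmod u) \<partial>lborel) \<partial>lborel)"
    using assms weighted_integral_insert_left[of J "insert b L" a \<alpha> 1 1]
      weighted_integral_insert_right[of J L b \<alpha> _ 1] by simp
  also have "\<dots> = (\<integral>\<^sup>+z. \<integral>\<^sup>+u. disc_power (\<alpha> a) z * disc_power (\<alpha> b) u *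
       weighted_integral \<alpha> J L (cmod z) (cmod u) \<partial>lborel \<partial>lborel)"
    by (subst nn_integral_cmult[symmetric]) (auto simp: mult.assoc)
  also have "\<dots> = disc_integral (\<alpha> a + \<alpha> b + 1) *
    ((\<integral>\<^sup>+w. disc_power (\<alpha> a) w * weighted_integral \<alpha> J L (cmod w) 1 \<partial>lborel) +
     (\<integral>\<^sup>+w. disc_power (\<alpha> b) w * weighted_integral \<alpha> J L 1 (cmod w) \<partial>lborel))"
    by (rule disc_pair_integral) (auto simp: weighted_integral_scale)
  finally show ?thesis
    using assms by (simp add: weighted_integral_insert_left weighted_integral_insert_right)
qed

lemma weighted_integral_empty_left: "weighted_integral \<alpha> {} L 1 1 = 0"
proof -
  have zero: "(\<Prod>i\<in>{} \<union> L. disc_power (\<alpha> i) (z i)) *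
      (if 1 * (\<Prod>j\<in>{}. cmod (z j)) < 1 * (\<Prod>l\<in>L. cmod (z l)) then 1 else 0) = 0" for z
  proof (cases "finite L \<and> (\<exists>i\<in>L. \<not> cmod (z i) < 1)")
    case True
    then have "(\<Prod>i\<in>L. disc_power (\<alpha> i) (z i)) = 0" by (auto simp: disc_power_def)
    then show ?thesis by simp
  next
    case False
    have "(\<Prod>l\<in>L. cmod (z l)) \<le> 1"
    proof (cases "finite L")
      case True
      with False show ?thesis by (intro prod_le_1) (simp add: less_imp_le)
    qed simp
    then show ?thesis by simp
  qed
  show ?thesis by (simp only: weighted_integral_def zero nn_integral_const) simp
qed

lemma weighted_integral_empty_right:
  assumes "finite J" "J \<noteq> {}"
  shows "weighted_integral \<alpha> J {} 1 1 = (\<Prod>j\<in>J. disc_integral (\<alpha> j))"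
proof -
  have "(\<Prod>i\<in>J. disc_power (\<alpha> i) (z i)) * (if (\<Prod>j\<in>J. cmod (z j)) < 1 then 1 else 0) =
    (\<Prod>i\<in>J. disc_power (\<alpha> i) (z i))" for z
  proof (cases "\<exists>i\<in>J. \<not> cmod (z i) < 1")
    case True
    then have "(\<Prod>i\<in>J. disc_power (\<alpha> i) (z i)) = 0"
      using assms by (auto simp: disc_power_def)
    then show ?thesis by simp
  next
    case False
    from assms obtain j where j: "j \<in> J" by auto
    have "(\<Prod>j\<in>J. cmod (z j)) = cmod (z j) * (\<Prod>j\<in>J - {j}. cmod (z j))"
      using j assms by (simp add: prod.remove)
    also have "\<dots> \<le> cmod (z j) * 1"
      using False by (intro mult_left_mono prod_le_1) (auto intro: less_imp_le)
    also have "\<dots> < 1" using j False by auto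
    finally show ?thesis by simp
  qed
  then show ?thesis
    using assms
      lborel_product.product_nn_integral_prod[of J "\<lambda>i. disc_power (\<alpha> i)"]
    by (simp add: weighted_integral_def disc_integral_def)
qed

section \<open>The closed formula\<close>

lemma denom_insert_right:
  assumes "finite J" "finite L" "j \<notin> J" "l \<notin> L"
  shows "denom x (insert j J) (insert l L) = denom x (insert j J) L * (\<Prod>i\<in>J. x i + x l) * (x j + x l)"
  using assms by (simp add: denom_def prod.distrib mult_ac)

lemma denom_insert_left:
  assumes "finite J" "finite L" "j \<notin> J" "l \<notin> L"
  shows "denom x (insert j J) (insert l L) =
    denom x J (insert l L) * (x j * (\<Prod>k\<in>L. x j + x k)) * (x j + x l)"
  using assms by (simp add: denom_def prod.distrib mult_ac)

lemma denom_pos: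
  fixes x :: "nat \<Rightarrow> 'a::linordered_idom"
  assumes "\<forall>j\<in>J. x j > 0 \<and> (\<forall>l\<in>L. x j + x l > 0)"
  shows "denom x J L > 0"
  unfolding denom_def using assms by (auto intro!: mult_pos_pos prod_pos)

text \<open>
  The induction scheme of the recursion for the integrals.
\<close>
lemma staircase_induct [case_names left right step]:
  fixes js ls :: "nat list"
  assumes "\<And>ls. P [] ls" "\<And>j js. P (j # js) []"
    and "\<And>j js l ls. P (j # js) ls \<Longrightarrow> P js (l # ls) \<Longrightarrow> P (j # js) (l # ls)"
  shows "P js ls"
  by (rule numer.induct[of "\<lambda>_ :: nat \<Rightarrow> int. P"]) (use assms in auto)

text \<open>
  For empty \<open>js\<close> both the integral and the numerator vanish, and the condition is vacuous.
\<close>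
lemma weighted_integral_eq:
  fixes \<alpha> :: "nat \<Rightarrow> int"
  defines "x \<equiv> (\<lambda>i. real_of_int (\<alpha> i + 1))"
  assumes "distinct js" "distinct ls" "set js \<inter> set ls = {}"
  shows "weighted_integral \<alpha> (set js) (set ls) 1 1 =
    (if \<forall>j\<in>set js. x j > 0 \<and> (\<forall>l\<in>set ls. x j + x l > 0)
     then ennreal (pi ^ (length js + length ls) * (numer x js ls / denom x (set js) (set ls)))
     else \<infinity>)"
  using assms(2-)
proof (induction js ls rule: staircase_induct)
  case (left ls)
  then show ?case by (simp add: weighted_integral_empty_left)
next
  case (right j js)
  let ?J = "set (j # js)"
  have eq: "weighted_integral \<alpha> ?J {} 1 1 = (\<Prod>i\<in>?J. disc_integral (\<alpha> i))"
    by (rule weighted_integral_empty_right) auto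
  have D: "disc_integral (\<alpha> i) = (if x i > 0 then ennreal (pi / x i) else \<infinity>)" for i
    by (simp add: disc_integral_eq x_def)
  show ?case
  proof (cases "\<forall>i\<in>?J. x i > 0")
    case True
    have "(\<Prod>i\<in>?J. disc_integral (\<alpha> i)) = (\<Prod>i\<in>?J. ennreal (pi / x i))"
      using True by (intro prod.cong) (auto simp: D)
    also have "\<dots> = ennreal (\<Prod>i\<in>?J. pi / x i)"
      using True by (intro prod_ennreal) (auto intro: less_imp_le)
    also have "(\<Prod>i\<in>?J. pi / x i) = pi ^ length (j # js) / (\<Prod>i\<in>?J. x i)"
      using right by (simp add: prod_dividef distinct_card)
    finally show ?thesis using True eq by (simp add: denom_def)
  next
    case False
    then obtain i where i: "i \<in> ?J" "\<not> x i > 0" by auto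
    have "(\<Prod>i\<in>?J - {i}. disc_integral (\<alpha> i)) \<noteq> 0"
      by (auto simp: D)
    then have "(\<Prod>i\<in>?J. disc_integral (\<alpha> i)) = \<infinity>"
      using i by (subst prod.remove[of _ i]) (auto simp: D ennreal_top_mult)
    then show ?thesis using False eq by auto
  qed
next
  case (step j js l ls)
  let ?s = "x j + x l"
  let ?N1 = "numer x (j # js) ls" and ?N2 = "numer x js (l # ls)"
  let ?D1 = "denom x (set (j # js)) (set ls)" and ?D2 = "denom x (set js) (set (l # ls))"
  let ?W1 = "weighted_integral \<alpha> (set (j # js)) (set ls) 1 1"
  let ?W2 = "weighted_integral \<alpha> (set js) (set (l # ls)) 1 1"
  let ?P = "\<lambda>J L. \<forall>j\<in>J. x j > 0 \<and> (\<forall>l\<in>L. x j + x l > 0)"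
  let ?k = "length js + length ls + 1"
  have k: "?k = length (j # js) + length ls" "?k = length js + length (l # ls)" by simp_all
  have W1: "?W1 = (if ?P (set (j # js)) (set ls) then ennreal (pi ^ ?k * (?N1 / ?D1)) else \<infinity>)"
    unfolding k(1) by (rule step.IH(1)) (use step.prems in auto)
  have W2: "?W2 = (if ?P (set js) (set (l # ls)) then ennreal (pi ^ ?k * (?N2 / ?D2)) else \<infinity>)"
    unfolding k(2) by (rule step.IH(2)) (use step.prems in auto)
  have "disc_integral (\<alpha> j + \<alpha> l + 1) = (if ?s > 0 then ennreal (pi / ?s) else \<infinity>)"
    by (simp add: disc_integral_eq x_def algebra_simps)
  moreover have "weighted_integral \<alpha> (set (j # js)) (set (l # ls)) 1 1 =
      disc_integral (\<alpha> j + \<alpha> l + 1) * (?W1 + ?W2)"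
    unfolding list.set by (rule weighted_integral_insert_both) (use step.prems in auto)
  ultimately have W: "weighted_integral \<alpha> (set (j # js)) (set (l # ls)) 1 1 =
      (if ?s > 0 then ennreal (pi / ?s) else \<infinity>) * (?W1 + ?W2)"
    by (simp only:)
  show ?case
  proof (cases "?P (set (j # js)) (set (l # ls))")
    case True
    then have P: "?s > 0" "?P (set (j # js)) (set ls)" "?P (set js) (set (l # ls))" by auto
    have D: "?D1 > 0" "?D2 > 0" using denom_pos[OF P(2)] denom_pos[OF P(3)] .
    have nonneg: "x i \<ge> 0" if "i \<in> set (j # js)" for i
      using True that by (auto intro: less_imp_le)
    have nonneg_sum: "x i + x k \<ge> 0" if "i \<in> set (j # js)" "k \<in> set (l # ls)" for i k
    proof -
      have "x i + x k > 0" using True that by blast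
      then show ?thesis by (rule less_imp_le)
    qed
    have N: "?N1 \<ge> 0" "?N2 \<ge> 0"
      by (rule numer_nonneg; intro ballI nonneg nonneg_sum; simp)+
    let ?A = "\<Prod>i\<in>set js. x i + x l" and ?B = "x j * (\<Prod>k\<in>set ls. x j + x k)"
    let ?D = "denom x (set (j # js)) (set (l # ls))"
    have eqD: "?D = ?D1 * ?A * ?s" "?D = ?D2 * ?B * ?s"
      using step.prems denom_insert_right[of "set js" "set ls" j l x]
        denom_insert_left[of "set js" "set ls" j l x] by auto
    have "?D > 0" using True by (intro denom_pos)
    then have "?D \<noteq> 0" by simp
    have factor_nz: "a \<noteq> 0" if "u \<noteq> 0" "u = d * a * c" for u d a c :: real
      using that by auto
    have nz: "?A \<noteq> 0" "?B \<noteq> 0"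
      using factor_nz[OF \<open>?D \<noteq> 0\<close> eqD(1)] factor_nz[OF \<open>?D \<noteq> 0\<close> eqD(2)] .
    have rescale: "p / c * (q * (n / d) + q * (m / e)) = q * p * (n / (d * c) + m / (e * c))"
      for p q c n d m e :: real
      by (simp add: algebra_simps)
    have cancel: "n / (d * c) = n * a / (d * a * c)" if "a \<noteq> 0" for n d c a :: real
      using that by simp
    have "pi / ?s * (pi ^ ?k * (?N1 / ?D1) + pi ^ ?k * (?N2 / ?D2)) =
      pi ^ (?k + 1) * (?N1 / (?D1 * ?s) + ?N2 / (?D2 * ?s))"
      by (simp only: rescale power_add power_one_right)
    also have "?N1 / (?D1 * ?s) = ?N1 * ?A / ?D"
      unfolding eqD(1) by (rule cancel[OF nz(1)])
    also have "?N2 / (?D2 * ?s) = ?N2 * ?B / ?D"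
      unfolding eqD(2) by (rule cancel[OF nz(2)])
    also have "?N1 * ?A / ?D + ?N2 * ?B / ?D = numer x (j # js) (l # ls) / ?D"
      by (simp only: numer.simps add_divide_distrib)
    finally have sum_eq: "pi / ?s * (pi ^ ?k * (?N1 / ?D1) + pi ^ ?k * (?N2 / ?D2)) =
      pi ^ (?k + 1) * (numer x (j # js) (l # ls) / ?D)" .
    have "0 \<le> pi ^ ?k * (?N1 / ?D1)" "0 \<le> pi ^ ?k * (?N2 / ?D2)" "0 \<le> pi / ?s"
      by (intro mult_nonneg_nonneg divide_nonneg_pos N D P(1) zero_le_power pi_ge_zero)+
    then have "ennreal (pi / ?s) * (ennreal (pi ^ ?k * (?N1 / ?D1)) + ennreal (pi ^ ?k * (?N2 / ?D2))) =
        ennreal (pi ^ (?k + 1) * (numer x (j # js) (l # ls) / ?D))"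
      unfolding sum_eq[symmetric]
      by (simp only: ennreal_plus ennreal_mult add_nonneg_nonneg)
    moreover have "?k + 1 = length (j # js) + length (l # ls)" by simp
    ultimately show ?thesis
      unfolding W W1 W2 if_P[OF True] if_P[OF P(1)] if_P[OF P(2)] if_P[OF P(3)]
      by (simp only:)
  next
    case False
    \<comment> \<open>If only the condition on \<open>j\<close> and \<open>l\<close> fails, the first factor is infinite; the product is then infinite
      because the sum is not zero.\<close>
    have W1_nz: "?W1 \<noteq> 0"
    proof (cases "?P (set (j # js)) (set ls)")
      case True
      have "?N1 > 0" by (rule numer_pos) (use True in \<open>simp_all add: less_imp_le\<close>)
      moreover have "?D1 > 0" by (rule denom_pos) (rule True)
      ultimately have "pi ^ ?k * (?N1 / ?D1) > 0" by (intro mult_pos_pos divide_pos_pos) auto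
      then show ?thesis
        unfolding W1 if_P[OF True] by (simp only: ennreal_eq_0_iff not_le)
    next
      case False
      show ?thesis unfolding W1 if_not_P[OF False] by simp
    qed
    have sum: "?s > 0 \<Longrightarrow> ?W1 + ?W2 = \<infinity>"
    proof -
      assume "?s > 0"
      have "\<not> ?P (set (j # js)) (set ls) \<or> \<not> ?P (set js) (set (l # ls))"
        using False \<open>?s > 0\<close> by auto
      then have "?W1 = \<infinity> \<or> ?W2 = \<infinity>"
        unfolding W1 W2 by argo
      then show ?thesis by auto
    qed
    have absorb: "(if c > 0 then ennreal (pi / c) else \<infinity>) * (v + w) = \<infinity>"
      if "v \<noteq> 0" "c > 0 \<Longrightarrow> v + w = \<infinity>" for c v w
      using that by (auto simp: ennreal_top_mult ennreal_mult_top)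
    show ?thesis
      unfolding W if_not_P[OF False] by (rule absorb[OF W1_nz sum])
  qed
qed

lemma norm_sq_eq_weighted_integral:
  assumes "s \<le> n"
  shows "norm_sq n s \<alpha> = weighted_integral \<alpha> {1..s} {s+1..n} 1 1"
proof -
  have un: "{1..s} \<union> {s+1..n} = {1..n}" using assms by auto
  show ?thesis
    unfolding norm_sq_def weighted_integral_def lborel_Cn_def un
  proof (rule nn_integral_cong)
    fix z :: "nat \<Rightarrow> complex"
    assume "z \<in> space (Pi\<^sub>M {1..n} (\<lambda>_. lborel))"
    then have z: "z \<in> {1..n} \<rightarrow>\<^sub>E UNIV" by (simp add: space_PiM)
    show "ennreal ((cmod (monomial_fun n \<alpha> z))\<^sup>2) * indicator (model_domain n s) z =
      (\<Prod>i\<in>{1..n}. disc_power (\<alpha> i) (z i)) *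
      (if 1 * (\<Prod>j\<in>{1..s}. cmod (z j)) < 1 * (\<Prod>l\<in>{s+1..n}. cmod (z l)) then 1 else 0)"
    proof (cases "\<forall>j\<in>{1..n}. cmod (z j) < 1")
      case True
      have "(\<Prod>i\<in>{1..n}. disc_power (\<alpha> i) (z i)) = (\<Prod>i\<in>{1..n}. ennreal ((cmod (z i) powi \<alpha> i)\<^sup>2))"
        using True by (intro prod.cong) (auto simp: disc_power_def)
      also have "\<dots> = ennreal ((cmod (monomial_fun n \<alpha> z))\<^sup>2)"
        by (simp add: prod_ennreal monomial_fun_def norm_power_int prod_power_distrib flip: prod_norm)
      finally show ?thesis
        using True z by (simp add: model_domain_def polydisc_def indicator_def flip: prod_norm)
    next
      case False
      then have "(\<Prod>i\<in>{1..n}. disc_power (\<alpha> i) (z i)) = 0"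
        by (auto simp: disc_power_def)
      moreover have "z \<notin> model_domain n s"
        using False by (auto simp: model_domain_def polydisc_def)
      ultimately show ?thesis by simp
    qed
  qed
qed

theorem theorem3p1:
  fixes n s :: nat
  assumes "n \<ge> 2" and "1 \<le> s" and "s \<le> n - 1"
  shows
    "(\<forall>\<alpha> :: nat \<Rightarrow> int. let \<beta> = (\<lambda>j. \<alpha> j + 1) in
        norm_sq n s \<alpha> < \<infinity> \<longleftrightarrow>
        (\<forall>j\<in>{1..s}. \<forall>l\<in>{s+1..n}. \<beta> j > 0 \<and> \<beta> j + \<beta> l > 0))
   \<and> (\<exists>R S :: int_mpoly.
        mvars R \<subseteq> {1..n} \<and> mvars S \<subseteq> {1..n}
      \<and> S = (\<Prod>j=1..s. mvar j) * (\<Prod>j=1..s. \<Prod>l=s+1..n. (mvar j + mvar l))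
      \<and> (\<exists>d. homogeneous_of_degree d S)
      \<and> homogeneous_of_degree ((n - s) * (s - 1)) R
      \<and> no_common_factor R S
      \<and> (\<forall>\<alpha> :: nat \<Rightarrow> int. let \<beta> = (\<lambda>j. \<alpha> j + 1) in
           norm_sq n s \<alpha> < \<infinity> \<longrightarrow>
           enn2real (norm_sq n s \<alpha>) = pi ^ n * (real_of_int (meval R \<beta>) / real_of_int (meval S \<beta>)))
      \<and> (s = 1 \<longrightarrow> R = 1))"
proof (intro conjI allI)
  define js ls where "js = [1..<s+1]" and "ls = [s+1..<n+1]"
  have sets: "set js = {1..s}" "set ls = {s+1..n}"
    unfolding js_def ls_def set_upt by auto
  have dist: "distinct js" "distinct ls" "set js \<inter> set ls = {}"
    unfolding sets by (auto simp: js_def ls_def)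
  have len: "length js = s" "length ls = n - s" by (auto simp: js_def ls_def)
  have js_ne: "js \<noteq> []" using assms by (simp add: js_def)
  have n: "n \<in> {s+1..n}" using assms by auto
  let ?x = "\<lambda>(\<alpha> :: nat \<Rightarrow> int) i. real_of_int (\<alpha> i + 1)"
  have eq: "norm_sq n s \<alpha> =
    (if \<forall>j\<in>{1..s}. ?x \<alpha> j > 0 \<and> (\<forall>l\<in>{s+1..n}. ?x \<alpha> j + ?x \<alpha> l > 0)
     then ennreal (pi ^ n * (numer (?x \<alpha>) js ls / denom (?x \<alpha>) {1..s} {s+1..n}))
     else \<infinity>)" for \<alpha>
    using weighted_integral_eq[OF dist, of \<alpha>] norm_sq_eq_weighted_integral[of s n \<alpha>] assms
    unfolding sets len by simp
  \<comment> \<open>Because \<open>l\<close> ranges over a nonempty set, quantifying over it loses no condition on \<open>\<beta>\<^sub>j\<close> alone.\<close>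
  have cond: "(\<forall>j\<in>{1..s}. ?x \<alpha> j > 0 \<and> (\<forall>l\<in>{s+1..n}. ?x \<alpha> j + ?x \<alpha> l > 0)) \<longleftrightarrow>
      (\<forall>j\<in>{1..s}. \<forall>l\<in>{s+1..n}. \<alpha> j + 1 > 0 \<and> (\<alpha> j + 1) + (\<alpha> l + 1) > 0)" for \<alpha>
    unfolding of_int_add[symmetric] of_int_0_less_iff using n by blast
  have fin: "norm_sq n s \<alpha> < \<infinity> \<longleftrightarrow>
      (\<forall>j\<in>{1..s}. ?x \<alpha> j > 0 \<and> (\<forall>l\<in>{s+1..n}. ?x \<alpha> j + ?x \<alpha> l > 0))" for \<alpha>
    unfolding eq by (simp only: split: if_split) simp
  show "let \<beta> = (\<lambda>j. \<alpha> j + 1) in norm_sq n s \<alpha> < \<infinity> \<longleftrightarrow>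
        (\<forall>j\<in>{1..s}. \<forall>l\<in>{s+1..n}. \<beta> j > 0 \<and> \<beta> j + \<beta> l > 0)" for \<alpha>
    unfolding Let_def fin cond ..
  define R S :: int_mpoly
    where "R = numer mvar js ls" and "S = denom mvar {1..s} {s+1..n}"
  have val: "poly_eval (\<lambda>_. 1::int) R > 0" "poly_eval (\<lambda>_. 1::int) S > 0"
    unfolding R_def S_def poly_eval_numer poly_eval_denom
    using numer_pos[of js "\<lambda>_. 1::int" ls] js_ne by (auto intro!: denom_pos)
  have nz: "R \<noteq> 0" "S \<noteq> 0" using val by force+
  have formR: "form_in {1..n} ((n - s) * (s - 1)) R"
    using form_in_numer[of js "{1..n}" ls] dist assms by (simp add: R_def sets len)
  have formS: "form_in {1..n} (s * 1 + s * ((n - s) * 1)) S"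
  proof -
    have "form_in {1..n} (card {1..s} * 1 + card {1..s} * (card {s+1..n} * 1)) S"
      unfolding S_def denom_def
      by (intro form_in_mult form_in_prod form_in_add form_in_mvar) (use assms in auto)
    then show ?thesis by simp
  qed
  have norm: "enn2real (norm_sq n s \<alpha>) =
      pi ^ n * (real_of_int (meval R \<beta>) / real_of_int (meval S \<beta>))"
    if \<beta>: "\<beta> = (\<lambda>j. \<alpha> j + 1)" and finite: "norm_sq n s \<alpha> < \<infinity>" for \<alpha> \<beta>
  proof -
    have P: "\<forall>j\<in>{1..s}. ?x \<alpha> j > 0 \<and> (\<forall>l\<in>{s+1..n}. ?x \<alpha> j + ?x \<alpha> l > 0)"
      using finite unfolding fin .
    have "numer (?x \<alpha>) js ls > 0" "denom (?x \<alpha>) {1..s} {s+1..n} > 0"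
      using P js_ne by (auto intro!: numer_pos denom_pos simp: sets less_imp_le)
    moreover have "numer (?x \<alpha>) js ls = real_of_int (meval R \<beta>)"
      by (simp add: R_def meval_eq_poly_eval poly_eval_numer of_int_numer \<beta>)
    moreover have "denom (?x \<alpha>) {1..s} {s+1..n} = real_of_int (meval S \<beta>)"
      by (simp add: S_def meval_eq_poly_eval poly_eval_denom of_int_denom \<beta>)
    moreover have "norm_sq n s \<alpha> =
        ennreal (pi ^ n * (numer (?x \<alpha>) js ls / denom (?x \<alpha>) {1..s} {s+1..n}))"
      unfolding eq if_P[OF P] ..
    ultimately show ?thesis by simp
  qed
  have "R = 1" if "s = 1"
    using numer_singleton[of mvar 1 ls] that by (simp add: R_def js_def)
  moreover have "no_common_factor R S"
    using no_common_factor_numer_denom[OF dist js_ne] by (simp add: R_def S_def sets)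
  ultimately show "\<exists>R S :: int_mpoly.
        mvars R \<subseteq> {1..n} \<and> mvars S \<subseteq> {1..n}
      \<and> S = (\<Prod>j=1..s. mvar j) * (\<Prod>j=1..s. \<Prod>l=s+1..n. (mvar j + mvar l))
      \<and> (\<exists>d. homogeneous_of_degree d S)
      \<and> homogeneous_of_degree ((n - s) * (s - 1)) R
      \<and> no_common_factor R S
      \<and> (\<forall>\<alpha> :: nat \<Rightarrow> int. let \<beta> = (\<lambda>j. \<alpha> j + 1) in
           norm_sq n s \<alpha> < \<infinity> \<longrightarrow>
           enn2real (norm_sq n s \<alpha>) = pi ^ n * (real_of_int (meval R \<beta>) / real_of_int (meval S \<beta>)))
      \<and> (s = 1 \<longrightarrow> R = 1)"
    using form_in_imp[OF formR nz(1)] form_in_imp[OF formS nz(2)] norm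
    unfolding Let_def
    by (intro exI[of _ R] exI[of _ S]) (auto simp: S_def denom_def)
qed

end
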